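(* Let $\Omega\subset\mathbb{R}$ be a countable set of nonzero real numbers with $\#\Omega\ge5$ and let $a:\Omega\to\mathbb{C}\setminus\{0\}$ satisfy $a(\omega)>0$ for all $\omega\in\Omega$ and $\sum_{\omega\in\Omega}|a(\omega)|<\infty$. Assume that $\Omega$ is linearly independent over $\mathbb{Q}$. Write $\Pi=(\Omega,a)$, $f_\Pi(t):=\sum_{\omega\in\Omega}a(\omega)e^{-it\omega}$ and $g_\Pi(t):=f_\Pi(t)-f_\Pi(0)$ for $t\in\mathbb{R}$. For $y>0$, let $\mu_{\Pi,y}$ be the infinitely divisible distribution on $\mathbb{R}$ with characteristic function $\exp(y\Re(g_\Pi(t)))=\int_{\mathbb{R}}e^{itx}\mu_{\Pi,y}(dx)$, and let $M_\Pi^{\Re}$ be the $M$-function of $\Re(f_\Pi)$ (see context). Then the point mass of $\mu_{\Pi,y}$ at the origin is $$\mu_{\Pi,y}(\{0\})=\exp(-y f_\Pi(0))\,\widetilde{M_\Pi^{\Re}}(-iy)=\exp(-y f_\Pi(0))\prod_{\omega\in\Omega}J_0(iy|a(\omega)|),$$ where $$\widetilde{M_\Pi^{\Re}}(z)=\frac{1}{\sqrt{2\pi}}\int_{\mathbb{R}}M_\Pi^{\Re}(u)e^{izu}\,du\qquad(z\in\mathbb{C}).$$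
   Context: $J_0$ is the Bessel function of the first kind of order zero. A distribution on $\mathbb{R}$ means a Borel probability measure; it is infinitely divisible if for every positive integer $n$ it is the $n$-fold convolution of some distribution with itself. Under the stated hypotheses $\mu_{\Pi,y}$ exists for every $y>0$. Under the stated hypotheses, the $M$-function $M_\Pi^{\Re}:\mathbb{R}\to\mathbb{R}_{\ge0}$ exists; it is the continuous, nonnegative, compactly supported function with $$\lim_{T\to\infty}\frac1T\int_0^T\Phi(\Re(f_\Pi(t)))\,dt=\frac{1}{\sqrt{2\pi}}\int_{\mathbb{R}}M_\Pi^{\Re}(u)\Phi(u)\,du$$ for every locally Riemann integrable $\Phi:\mathbb{R}\to\mathbb{C}$ (Riemann integrable on every bounded interval). Equivalently, $M_\Pi^{\Re}(u)=\frac{1}{\sqrt{2\pi}}\int_{\mathbb{R}}M_\Pi(u+iv)\,dv$, where $M_\Pi:\mathbb{C}\to\mathbb{R}_{\ge0}$ is the continuous compactly supported function with $\lim_{T\to\infty}\frac1T\int_0^T\Phi(f_\Pi(t))\,dt=\int_{\mathbb{C}}M_\Pi(u+iv)\Phi(u+iv)\,\frac{du\,dv}{2\pi}$ for every locally Riemann integrable $\Phi:\mathbb{C}\to\mathbb{C}$. *)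

theory Defs
  imports "HOL-Probability.Probability"
begin

definition f_Pi :: "real set \<Rightarrow> (real \<Rightarrow> complex) \<Rightarrow> real \<Rightarrow> complex" where
  "f_Pi \<Omega> a t = (\<Sum>\<^sub>\<infinity>\<omega>\<in>\<Omega>. a \<omega> * exp (- \<i> * of_real t * of_real \<omega>))"

definition g_Pi :: "real set \<Rightarrow> (real \<Rightarrow> complex) \<Rightarrow> real \<Rightarrow> complex" where
  "g_Pi \<Omega> a t = f_Pi \<Omega> a t - f_Pi \<Omega> a 0"

definition rat_independent :: "real set \<Rightarrow> bool" where
  "rat_independent S \<longleftrightarrow> module.independent (\<lambda>(q::rat) (x::real). of_rat q * x) S"

text \<open>The Bessel function of the first kind of order zero, by its power series.\<close>

definition bessel_J0 :: "complex \<Rightarrow> complex" where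
  "bessel_J0 z = (\<Sum>k. (- 1) ^ k / (fact k)\<^sup>2 * (z / 2) ^ (2 * k))"

text \<open>
  Products over a countable index set, taken as limits of the net of finite partial products
  (the multiplicative analogue of \<^const>\<open>has_sum\<close> and \<^const>\<open>infsum\<close>). As the value is only
  meaningful for a convergent net, convergence is a separate predicate.
\<close>

definition unordered_prod_converges :: "('i \<Rightarrow> complex) \<Rightarrow> 'i set \<Rightarrow> bool" where
  "unordered_prod_converges h A \<longleftrightarrow> (\<exists>p. ((\<lambda>F. \<Prod>i\<in>F. h i) \<longlongrightarrow> p) (finite_subsets_at_top A))"

definition unordered_prod :: "('i \<Rightarrow> complex) \<Rightarrow> 'i set \<Rightarrow> complex" where
  "unordered_prod h A = Lim (finite_subsets_at_top A) (\<lambda>F. \<Prod>i\<in>F. h i)"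

text \<open>
  The \<open>n\<close>-fold convolution power; the point mass at \<open>0\<close> is the neutral element.
\<close>

definition convolution_power :: "real measure \<Rightarrow> nat \<Rightarrow> real measure" where
  "convolution_power \<nu> n = (convolution \<nu> ^^ n) (return borel 0)"

definition infinitely_divisible :: "real measure \<Rightarrow> bool" where
  "infinitely_divisible \<mu> \<longleftrightarrow> real_distribution \<mu> \<and>
     (\<forall>n>0. \<exists>\<nu>. real_distribution \<nu> \<and> \<mu> = convolution_power \<nu> n)"

text \<open>
  The Riemann integral requires a mesh bound that is uniform over the interval; the
  library's \<^const>\<open>integrable_on\<close> is the strictly more general gauge integral.
\<close>

definition riemann_integrable :: "(real \<Rightarrow> complex) \<Rightarrow> real \<Rightarrow> real \<Rightarrow> bool" where
  "riemann_integrable \<Phi> a b \<longleftrightarrow>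
     (\<exists>I. \<forall>e>0. \<exists>d>0. \<forall>p. p tagged_division_of {a..b} \<and> (\<forall>(x, K)\<in>p. diameter K < d) \<longrightarrow>
        norm ((\<Sum>(x, K)\<in>p. measure lborel K *\<^sub>R \<Phi> x) - I) < e)"

definition locally_riemann_integrable :: "(real \<Rightarrow> complex) \<Rightarrow> bool" where
  "locally_riemann_integrable \<Phi> \<longleftrightarrow> (\<forall>a b. a \<le> b \<longrightarrow> riemann_integrable \<Phi> a b)"

text \<open>
  \<open>M\<close> is the \<open>M\<close>-function of the real-valued function \<open>h\<close>.

  A Riemann integrable \<open>\<Phi>\<close> need not be Borel measurable, so the integrals below are gauge
  integrals rather than integrals with respect to \<^const>\<open>lborel\<close>. In the uses here the
  integrands are bounded on bounded sets, where gauge and Lebesgue integral coincide.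
  The composition \<open>\<lambda>t. \<Phi> (h t)\<close> need not be measurable even for continuous \<open>h\<close>; the
  mean value is only required when the integrals over \<open>{0..T}\<close> exist, since
  \<^const>\<open>integral\<close> returns \<open>0\<close> otherwise. The condition is automatic for continuous
  \<open>h\<close> and \<open>\<Phi>\<close>, and continuous \<open>\<Phi>\<close> already determine \<open>M\<close>.
\<close>

definition is_M_function :: "(real \<Rightarrow> real) \<Rightarrow> (real \<Rightarrow> real) \<Rightarrow> bool" where
  "is_M_function h M \<longleftrightarrow>
     continuous_on UNIV M \<and> (\<forall>u. 0 \<le> M u) \<and> compact (closure {u. M u \<noteq> 0}) \<and>
     (\<forall>\<Phi> :: real \<Rightarrow> complex.
        locally_riemann_integrable \<Phi> \<and> (\<forall>T>0. (\<lambda>t. \<Phi> (h t)) integrable_on {0..T}) \<longrightarrow>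
        ((\<lambda>T. (1 / T) *\<^sub>R integral {0..T} (\<lambda>t. \<Phi> (h t))) \<longlongrightarrow>
           of_real (1 / sqrt (2 * pi)) * integral UNIV (\<lambda>u. of_real (M u) * \<Phi> u)) at_top)"

definition M_transform :: "(real \<Rightarrow> real) \<Rightarrow> complex \<Rightarrow> complex" where
  "M_transform M z =
     of_real (1 / sqrt (2 * pi)) * integral UNIV (\<lambda>u. of_real (M u) * exp (\<i> * z * of_real u))"

end

theory Submission
  imports Defs
begin

text \<open>
  The point mass at the origin is the time average of the characteristic function. Here this
  function is \<open>exp (y * h t - y * h 0)\<close> with \<open>h\<close> the real part of \<open>f_Pi\<close>, and the
  \<open>M\<close>-function evaluates the average of \<open>exp (y * h t)\<close> with the test function \<open>exp (y * u)\<close>.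
  On the other hand \<open>h\<close> is a uniform limit of finite sums of \<open>norm (a w) * cos (w * t)\<close>, and by
  rational independence the average of a finite product of factors \<open>exp (x * cos (w * t))\<close> is
  the product of their averages, each of which is \<open>bessel_J0 (\<i> * x)\<close>.
\<close>

section \<open>Time averages\<close>

text \<open>Continuity is bundled in so that all integrals over \<open>{0..T}\<close> exist. Without
  it \<open>integral\<close> could fall back to its default value 0, and linearity would
  fail.\<close>

definition has_mean :: "(real \<Rightarrow> complex) \<Rightarrow> complex \<Rightarrow> bool" where
  "has_mean g m \<longleftrightarrow> continuous_on UNIV g \<and>
     ((\<lambda>T. (1 / T) *\<^sub>R integral {0..T} g) \<longlongrightarrow> m) at_top"

lemma has_mean_unique: "has_mean g m \<Longrightarrow> has_mean g m' \<Longrightarrow> m = m'"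
  unfolding has_mean_def by (auto intro: tendsto_unique[OF trivial_limit_at_top_linorder])

lemma integrable_continuous_UNIV:
  fixes g :: "real \<Rightarrow> complex"
  assumes "continuous_on UNIV g"
  shows "g integrable_on {a..b}"
  using assms by (auto intro!: integrable_continuous_interval intro: continuous_on_subset)

lemma has_mean_cmult:
  assumes "has_mean g m"
  shows "has_mean (\<lambda>t. c * g t) (c * m)"
proof -
  have "((\<lambda>T. c * ((1 / T) *\<^sub>R integral {0..T} g)) \<longlongrightarrow> c * m) at_top"
    using assms by (intro tendsto_intros) (simp add: has_mean_def)
  then show ?thesis
    using assms by (auto simp: has_mean_def intro!: continuous_intros)
qed

lemma has_mean_sum:
  assumes "\<And>i. i \<in> I \<Longrightarrow> has_mean (g i) (m i)"
  shows "has_mean (\<lambda>t. \<Sum>i\<in>I. g i t) (\<Sum>i\<in>I. m i)"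
proof (cases "finite I")
  case True
  have "((\<lambda>T. \<Sum>i\<in>I. (1 / T) *\<^sub>R integral {0..T} (g i)) \<longlongrightarrow> (\<Sum>i\<in>I. m i)) at_top"
    using assms by (intro tendsto_sum) (simp add: has_mean_def)
  also have "(\<lambda>T. \<Sum>i\<in>I. (1 / T) *\<^sub>R integral {0..T} (g i)) =
      (\<lambda>T. (1 / T) *\<^sub>R integral {0..T} (\<lambda>t. \<Sum>i\<in>I. g i t))"
    using assms True
    by (subst integral_sum) (auto simp: has_mean_def scaleR_sum_right intro: integrable_continuous_UNIV)
  finally show ?thesis
    using assms by (auto simp: has_mean_def intro!: continuous_intros)
\<comment> \<open>For infinite \<open>I\<close> both sums are 0 by convention, and the zero function
  has mean 0.\<close>
qed (simp add: has_mean_def)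

lemma integral_iexp_Icc:
  assumes "l \<noteq> 0" and "0 \<le> T"
  shows "integral {0..T} (\<lambda>t. iexp (l * t)) = (iexp (l * T) - 1) / (\<i> * of_real l)"
proof -
  have "((\<lambda>t. iexp (l * t)) has_integral
      (iexp (l * T) / (\<i> * of_real l) - iexp (l * 0) / (\<i> * of_real l))) {0..T}"
    using assms
    by (intro fundamental_theorem_of_calculus)
       (auto simp: mult_ac intro!: derivative_eq_intros has_vector_derivative_real_field)
  then show ?thesis
    by (simp add: diff_divide_distrib integral_unique)
qed

text \<open>Orthogonality of the characters: for \<open>l \<noteq> 0\<close> the primitive of the
  character is bounded, so its average decays like \<open>1 / T\<close>.\<close>

lemma has_mean_iexp: "has_mean (\<lambda>t. iexp (l * t)) (if l = 0 then 1 else 0)"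
proof (cases "l = 0")
  case True
  have "((\<lambda>T::real. 1::complex) \<longlongrightarrow> 1) at_top"
    by simp
  then have "((\<lambda>T::real. (1 / T) *\<^sub>R integral {0..T} (\<lambda>t. 1::complex)) \<longlongrightarrow> 1) at_top"
    by (rule Lim_transform_eventually)
       (auto simp: scaleR_conv_of_real intro!: eventually_mono[OF eventually_gt_at_top[of 0]])
  then show ?thesis
    using True by (simp add: has_mean_def)
next
  case False
  have "((\<lambda>T. (1 / T) *\<^sub>R integral {0..T} (\<lambda>t. iexp (l * t))) \<longlongrightarrow> 0) at_top"
  proof (rule Lim_null_comparison)
    have "norm ((1 / T) *\<^sub>R integral {0..T} (\<lambda>t. iexp (l * t))) \<le> (2 / \<bar>l\<bar>) / T"
      if "T > 0" for T
    proof -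
      have "norm (iexp (l * T) - 1) \<le> norm (iexp (l * T)) + norm (1::complex)"
        by (rule norm_triangle_ineq4)
      also have "\<dots> = 2"
        by (simp add: norm_exp_i_times del: of_real_mult)
      finally show ?thesis
        using False that
        by (subst integral_iexp_Icc) (auto simp: norm_divide norm_mult divide_simps)
    qed
    then show "\<forall>\<^sub>F T in at_top. norm ((1 / T) *\<^sub>R integral {0..T} (\<lambda>t. iexp (l * t))) \<le> (2 / \<bar>l\<bar>) / T"
      by (intro eventually_mono[OF eventually_gt_at_top[of 0]])
    show "((\<lambda>T. (2 / \<bar>l\<bar>) / T) \<longlongrightarrow> 0) at_top"
      by (intro tendsto_divide_0[OF tendsto_const] filterlim_at_top_imp_at_infinity filterlim_ident)
  qed
  then show ?thesis
    using False by (auto simp: has_mean_def intro!: continuous_intros)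
qed

lemma norm_average_le:
  fixes g :: "real \<Rightarrow> complex"
  assumes "continuous_on UNIV g" and "\<And>t. norm (g t) \<le> e" and "T > 0"
  shows "norm ((1 / T) *\<^sub>R integral {0..T} g) \<le> e"
proof -
  have "norm (integral {0..T} g) \<le> integral {0..T} (\<lambda>t. e)"
    using assms by (intro integral_norm_bound_integral integrable_continuous_UNIV) auto
  also have "\<dots> = e * T"
    using assms by simp
  finally show ?thesis
    using assms by (simp add: field_simps)
qed

text \<open>Averaging over \<open>{0..T}\<close> does not increase the sup norm, so the averages
  converge at a rate independent of \<open>T\<close>. This uniformity permits exchanging the limit
  along \<open>F\<close> with the limit in \<open>T\<close>.\<close>

lemma uniform_limit_average:
  fixes g :: "'a \<Rightarrow> real \<Rightarrow> complex"
  assumes ul: "uniform_limit UNIV g h F"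
    and g: "\<forall>\<^sub>F n in F. continuous_on UNIV (g n)" and h: "continuous_on UNIV h"
  shows "uniform_limit {0<..} (\<lambda>n T. (1 / T) *\<^sub>R integral {0..T} (g n))
           (\<lambda>T. (1 / T) *\<^sub>R integral {0..T} h) F"
proof (rule uniform_limitI)
  fix e :: real assume "e > 0"
  then have "\<forall>\<^sub>F n in F. \<forall>t\<in>UNIV. dist (g n t) (h t) < e / 2"
    by (intro uniform_limitD[OF ul]) simp
  with g show "\<forall>\<^sub>F n in F. \<forall>T\<in>{0<..}. dist ((1 / T) *\<^sub>R integral {0..T} (g n))
      ((1 / T) *\<^sub>R integral {0..T} h) < e"
  proof eventually_elim
    case (elim n)
    show ?case
    proof
      fix T :: real assume T: "T \<in> {0<..}"
      have "norm ((1 / T) *\<^sub>R integral {0..T} (\<lambda>t. g n t - h t)) \<le> e / 2"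
        using elim h T
        by (intro norm_average_le) (auto simp: dist_norm less_imp_le intro!: continuous_intros)
      also have "integral {0..T} (\<lambda>t. g n t - h t) = integral {0..T} (g n) - integral {0..T} h"
        using elim h by (intro integral_diff integrable_continuous_UNIV)
      finally show "dist ((1 / T) *\<^sub>R integral {0..T} (g n)) ((1 / T) *\<^sub>R integral {0..T} h) < e"
        using \<open>e > 0\<close> by (simp add: dist_norm scaleR_diff_right)
    qed
  qed
qed

text \<open>First form of the exchange of limits: convergence of the means \<open>m n\<close>
  produces a mean of the limit function. It passes from truncated exponential series to full
  exponentials.\<close>

lemma has_mean_uniform_limit:
  assumes ul: "uniform_limit UNIV g h F" and F: "F \<noteq> bot"
    and g: "\<forall>\<^sub>F n in F. has_mean (g n) (m n)" and m: "(m \<longlongrightarrow> l) F"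
  shows "has_mean h l"
proof -
  have cont: "\<forall>\<^sub>F n in F. continuous_on UNIV (g n)"
    using g by eventually_elim (simp add: has_mean_def)
  then have h: "continuous_on UNIV h"
    using ul F by (rule uniform_limit_theorem)
  have "((\<lambda>T. (1 / T) *\<^sub>R integral {0..T} h) \<longlongrightarrow> l) at_top"
  proof (rule swap_uniform_limit'[OF _ m uniform_limit_average[OF ul cont h] _ F])
    show "\<forall>\<^sub>F n in F. ((\<lambda>T. (1 / T) *\<^sub>R integral {0..T} (g n)) \<longlongrightarrow> m n) at_top"
      using g by eventually_elim (simp add: has_mean_def)
  qed (simp add: eventually_gt_at_top)
  with h show ?thesis
    by (simp add: has_mean_def)
qed

text \<open>Second form of the exchange: here the mean of the limit function is known, and
  convergence of the means \<open>m n\<close> is the conclusion. The infinite Bessel product thus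
  converges without any estimate of its factors.\<close>

lemma tendsto_mean_uniform_limit:
  assumes ul: "uniform_limit UNIV g h F"
    and g: "\<forall>\<^sub>F n in F. has_mean (g n) (m n)" and h: "has_mean h l"
  shows "(m \<longlongrightarrow> l) F"
proof (rule tendstoI)
  fix e :: real assume "e > 0"
  have cont: "\<forall>\<^sub>F n in F. continuous_on UNIV (g n)"
    using g by eventually_elim (simp add: has_mean_def)
  have "uniform_limit {0<..} (\<lambda>n T. (1 / T) *\<^sub>R integral {0..T} (g n))
      (\<lambda>T. (1 / T) *\<^sub>R integral {0..T} h) F"
    using h by (intro uniform_limit_average[OF ul cont]) (simp add: has_mean_def)
  then have "\<forall>\<^sub>F n in F. \<forall>T\<in>{0<..}. dist ((1 / T) *\<^sub>R integral {0..T} (g n))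
      ((1 / T) *\<^sub>R integral {0..T} h) < e / 2"
    using \<open>e > 0\<close> by (intro uniform_limitD) auto
  with g show "\<forall>\<^sub>F n in F. dist (m n) l < e"
  proof eventually_elim
    case (elim n)
    have "((\<lambda>T. dist ((1 / T) *\<^sub>R integral {0..T} (g n)) ((1 / T) *\<^sub>R integral {0..T} h))
        \<longlongrightarrow> dist (m n) l) at_top"
      using elim h by (intro tendsto_dist) (auto simp: has_mean_def)
    moreover have "\<forall>\<^sub>F T in at_top. dist ((1 / T) *\<^sub>R integral {0..T} (g n))
        ((1 / T) *\<^sub>R integral {0..T} h) \<le> e / 2"
      using elim by (intro eventually_mono[OF eventually_gt_at_top[of 0]]) (auto intro: less_imp_le)
    ultimately have "dist (m n) l \<le> e / 2"
      by (intro tendsto_upperbound[where F = "at_top :: real filter"]) auto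
    with \<open>e > 0\<close> show ?case
      by simp
  qed
qed

section \<open>The mass of an atom\<close>

text \<open>By Fubini the average of \<open>char M\<close> is the \<open>M\<close>-integral of the
  averages \<open>?K T x\<close> of the characters. These are bounded by 1 and tend to the indicator
  of \<open>{0}\<close>, so dominated convergence applies.\<close>

lemma (in real_distribution) has_mean_char: "has_mean (char M) (of_real (measure M {0}))"
proof -
  interpret P: pair_sigma_finite lborel M ..
  have cont: "continuous_on UNIV (char M)"
    by (simp add: continuous_at_imp_continuous_on isCont_char)
  let ?K = "\<lambda>T x. (1 / T) *\<^sub>R integral {0..T} (\<lambda>t. iexp (x * t))"
  have int: "set_integrable lborel {0..T} g" if "continuous_on UNIV g" for T and g :: "real \<Rightarrow> complex"
    using that by (intro borel_integrable_atLeastAtMost') (auto intro: continuous_on_subset)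
  have K: "integral {0..T} (\<lambda>t. iexp (x * t)) = (CLBINT t. indicator {0..T} t *\<^sub>R iexp (t * x))" for T x
  proof -
    have "(CLBINT t:{0..T}. iexp (x * t)) = integral {0..T} (\<lambda>t. iexp (x * t))"
      by (intro set_borel_integral_eq_integral(2) int continuous_intros)
    then show ?thesis
      by (simp add: set_lebesgue_integral_def mult.commute)
  qed
  have swap: "(1 / T) *\<^sub>R integral {0..T} (char M) = (CLINT x|M. ?K T x)" if "T > 0" for T
  proof -
    have "integral {0..T} (char M) = (CLBINT t:{0..T}. char M t)"
      by (rule set_borel_integral_eq_integral(2)[OF int[OF cont], symmetric])
    also have "\<dots> = (CLBINT t. (CLINT x|M. indicator {0..T} t *\<^sub>R iexp (t * x)))"
      by (simp add: set_lebesgue_integral_def char_def)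
    also have "\<dots> = (CLINT x|M. (CLBINT t. indicator {0..T} t *\<^sub>R iexp (t * x)))"
    \<comment> \<open>The integrand is bounded by 1 and supported on
      \<open>{0..T} \<times> space M\<close>, which has finite measure.\<close>
    proof (intro P.Fubini_integral [symmetric] integrableI_bounded_set [where B = 1])
      show "{0..T} \<times> space M \<in> sets (lborel \<Otimes>\<^sub>M M)"
        by (intro pair_measureI) auto
      show "emeasure (lborel \<Otimes>\<^sub>M M) ({0..T} \<times> space M) < \<infinity>"
        using that by (subst emeasure_pair_measure_Times)
           (auto simp: ennreal_mult_less_top not_less top_unique)
    qed (auto split: split_indicator split_indicator_asm simp del: of_real_mult intro!: AE_I2)
    finally show ?thesis
      by (simp add: K del: of_real_mult)
  qed
  have "((\<lambda>T. CLINT x|M. ?K T x) \<longlongrightarrow> (CLINT x|M. of_real (indicator {0} x))) at_top"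
  proof (rule integral_dominated_convergence_at_top[where w = "\<lambda>_. 1"])
    show "\<forall>\<^sub>F T in at_top. AE x in M. norm (?K T x) \<le> 1"
      by (intro eventually_mono[OF eventually_gt_at_top[of 0]] AE_I2 norm_average_le)
         (auto intro!: continuous_intros simp del: of_real_mult)
    show "AE x in M. ((\<lambda>T. ?K T x) \<longlongrightarrow> of_real (indicator {0} x)) at_top"
    proof (intro AE_I2)
      fix x show "((\<lambda>T. ?K T x) \<longlongrightarrow> of_real (indicator {0} x)) at_top"
        using has_mean_iexp[of x] by (cases "x = 0") (auto simp: has_mean_def)
    qed
  next
    fix T :: real
    show "?K T \<in> borel_measurable M"
      \<comment> \<open>As a Lebesgue integral with parameter \<open>x\<close>, the kernel is
        measurable in \<open>x\<close>.\<close>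
      unfolding K by measurable
  qed auto
  then have "((\<lambda>T. (1 / T) *\<^sub>R integral {0..T} (char M)) \<longlongrightarrow> (CLINT x|M. of_real (indicator {0} x))) at_top"
    by (rule Lim_transform_eventually)
       (rule eventually_mono[OF eventually_gt_at_top[of 0]], simp only: swap)
  then show ?thesis
    using cont by (simp add: has_mean_def)
qed

section \<open>Finite sets of frequencies\<close>

text \<open>On the imaginary axis the signs of the series cancel and every term becomes a square
  (this is the modified Bessel function \<open>I_0\<close>). These squares are the diagonal terms
  that survive averaging below.\<close>

lemma sums_bessel_J0_imaginary:
  "(\<lambda>k. (of_real (x / 2) ^ k / fact k)\<^sup>2) sums bessel_J0 (\<i> * of_real x)"
proof -
  define c where "c = complex_of_real (x / 2)"
  have sq: "(c ^ k / fact k)\<^sup>2 = (c\<^sup>2) ^ k / fact k / fact k" for k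
    by (simp add: power2_eq_square power_mult_distrib)
  \<comment> \<open>Dropping one of the two factorials leaves the exponential series as a
    majorant.\<close>
  have "summable (\<lambda>k. norm (c\<^sup>2) ^ k / fact k)"
    using summable_exp[of "norm (c\<^sup>2)"] by (simp add: field_simps)
  then have "summable (\<lambda>k. (c ^ k / fact k)\<^sup>2)"
  proof (rule summable_comparison_test'[where N = 0])
    fix k :: nat
    have "norm ((c ^ k / fact k)\<^sup>2) = (norm (c\<^sup>2) ^ k / fact k) / fact k"
      by (simp only: sq norm_divide norm_power norm_fact)
    also have "\<dots> \<le> (norm (c\<^sup>2) ^ k / fact k) / 1"
      by (intro divide_left_mono) auto
    finally show "norm ((c ^ k / fact k)\<^sup>2) \<le> norm (c\<^sup>2) ^ k / fact k"
      by simp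
  qed
  moreover have "(- 1) ^ k / (fact k)\<^sup>2 * (\<i> * of_real x / 2) ^ (2 * k) = (c ^ k / fact k)\<^sup>2" for k
  proof -
    have "(\<i> * of_real x / 2)\<^sup>2 = - c\<^sup>2"
      by (simp add: c_def power_divide power_mult_distrib)
    then show ?thesis
      unfolding sq power_mult by (simp add: power2_eq_square flip: power_mult_distrib)
  qed
  ultimately show ?thesis
    unfolding bessel_J0_def c_def by (simp add: summable_sums)
qed

text \<open>The reals as a rational vector space, with the same scalar multiplication as in
  \<open>rat_independent\<close>, so that the theory of spans applies to it.\<close>

interpretation rat_real: vector_space "\<lambda>(q::rat) (x::real). of_rat q * x"
  by unfold_locales (auto simp: algebra_simps of_rat_add of_rat_mult)

text \<open>Both factors are power series in a character, which exposes the Fourier modes of the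
  left-hand side.\<close>

lemma exp_cos_eq:
  "exp (complex_of_real (x * cos \<theta>)) = exp (of_real (x / 2) * iexp \<theta>) * exp (of_real (x / 2) * iexp (- \<theta>))"
proof -
  have "complex_of_real (x * cos \<theta>) = of_real (x / 2) * iexp \<theta> + of_real (x / 2) * iexp (- \<theta>)"
    unfolding cis_conv_exp[symmetric] by (simp add: complex_eq_iff)
  then show ?thesis
    by (simp only: exp_add)
qed

lemma uniform_limit_exp_iexp:
  "uniform_limit UNIV (\<lambda>N t. \<Sum>j<N. of_real c ^ j / fact j * iexp (real j * (w * t)))
     (\<lambda>t. exp (complex_of_real c * iexp (w * t))) sequentially"
proof -
  have eq: "of_real c ^ j / fact j * iexp (real j * (w * t)) =
      (complex_of_real c * iexp (w * t)) ^ j /\<^sub>R fact j" for j t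
    by (simp add: power_mult_distrib scaleR_conv_of_real divide_inverse mult_ac
        flip: exp_of_nat_mult)
  have "uniform_limit UNIV (\<lambda>N t. \<Sum>j<N. (complex_of_real c * iexp (w * t)) ^ j /\<^sub>R fact j)
      (\<lambda>t. \<Sum>j. (complex_of_real c * iexp (w * t)) ^ j /\<^sub>R fact j) sequentially"
  proof (rule Weierstrass_m_test)
    show "summable (\<lambda>j. inverse (fact j) * \<bar>c\<bar> ^ j)"
      by (rule summable_exp)
    show "norm ((complex_of_real c * iexp (w * t)) ^ j /\<^sub>R fact j) \<le> inverse (fact j) * \<bar>c\<bar> ^ j"
      for j t
      by (simp add: norm_power norm_mult power_mult_distrib del: of_real_mult)
  qed
  moreover have "exp (complex_of_real c * iexp (w * t)) =
      (\<Sum>j. (complex_of_real c * iexp (w * t)) ^ j /\<^sub>R fact j)" for t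
    by (rule sums_unique[OF exp_converges])
  ultimately show ?thesis
    by (simp only: eq)
qed

text \<open>
  The twist by \<open>iexp (l * t)\<close> is what makes the induction on the set of frequencies work: it
  absorbs the Fourier modes of the factor that is split off.
\<close>

lemma has_mean_prod_exp_cos:
  assumes "finite F" and "rat_real.independent F" and "l \<in> rat_real.span F \<Longrightarrow> l = 0"
  shows "has_mean (\<lambda>t. iexp (l * t) * (\<Prod>w\<in>F. exp (complex_of_real (x w * cos (w * t)))))
           (if l = 0 then \<Prod>w\<in>F. bessel_J0 (\<i> * of_real (x w)) else 0)"
  using assms
proof (induction F arbitrary: l rule: finite_induct)
  case empty
  show ?case
    using has_mean_iexp[of l] by (cases "l = 0") auto
next
  case (insert w F)
  define G where "G t = (\<Prod>w\<in>F. exp (complex_of_real (x w * cos (w * t))))" for t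
  define P where "P = (\<Prod>w\<in>F. bessel_J0 (\<i> * of_real (x w)))"
  define c where "c j = complex_of_real (x w / 2) ^ j / fact j" for j :: nat
  \<comment> \<open>Truncated exponential series; \<open>s = 1\<close> and \<open>s = - 1\<close>
    give the two factors of \<open>exp_cos_eq\<close>.\<close>
  define p where "p s N t = (\<Sum>j<N. c j * iexp (real j * (s * w * t)))" for s N t
  have indep: "rat_real.independent F" and w: "w \<notin> rat_real.span F"
    using insert.prems(1) insert.hyps(2) by (auto simp: rat_real.independent_insert)
  have "w \<noteq> 0"
    using w rat_real.span_zero by auto
  \<comment> \<open>If \<open>l + q * w\<close> lies in the span of \<open>F\<close>, then
    \<open>l\<close> lies in the span of \<open>insert w F\<close>, so \<open>l = 0\<close> by
    assumption; then \<open>q * w\<close> lies in the span of \<open>F\<close>, which forces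
    \<open>q = 0\<close>. Hence every shifted frequency again satisfies the premise of the induction
    hypothesis.\<close>
  have coset: "l + q * w = 0 \<longleftrightarrow> l = 0 \<and> q = 0" and in_span: "l + q * w \<in> rat_real.span F \<longleftrightarrow> l = 0 \<and> q = 0"
    if "q \<in> \<rat>" for q
  proof -
    obtain r where r: "q = of_rat r"
      using \<open>q \<in> \<rat>\<close> by (auto elim: Rats_cases)
    have qw: "q * w \<in> rat_real.span (insert w F)"
      unfolding r by (intro rat_real.span_scale rat_real.span_base) simp
    show *: "l + q * w \<in> rat_real.span F \<longleftrightarrow> l = 0 \<and> q = 0"
    proof
      assume *: "l + q * w \<in> rat_real.span F"
      then have "l + q * w \<in> rat_real.span (insert w F)"
        using rat_real.span_mono[of F "insert w F"] by auto
      from rat_real.span_diff[OF this qw] have "l = 0"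
        using insert.prems(2) by simp
      moreover have "q = 0"
      proof (rule ccontr)
        assume "q \<noteq> 0"
        with * \<open>l = 0\<close> have "of_rat (inverse r) * (q * w) \<in> rat_real.span F"
          by (intro rat_real.span_scale) simp
        moreover have "of_rat (inverse r) * (q * w) = w"
          using \<open>q \<noteq> 0\<close> by (simp add: r flip: of_rat_mult mult.assoc)
        ultimately show False
          using w by simp
      qed
      ultimately show "l = 0 \<and> q = 0" ..
    qed (simp add: rat_real.span_zero)
    show "l + q * w = 0 \<longleftrightarrow> l = 0 \<and> q = 0"
      using * rat_real.span_zero[of F] by auto
  qed
  have mode: "has_mean (\<lambda>t. c j * (c k * (iexp ((l + (real j - real k) * w) * t) * G t)))
      (if l = 0 \<and> j = k then c j * (c j * P) else 0)" for j k
  proof -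
    have "has_mean (\<lambda>t. c j * (c k * (iexp ((l + (real j - real k) * w) * t) * G t)))
        (c j * (c k * (if l + (real j - real k) * w = 0 then P else 0)))"
      unfolding G_def P_def
      by (intro has_mean_cmult insert.IH indep) (simp add: in_span coset)
    then show ?thesis
      by (auto simp: coset)
  qed
  \<comment> \<open>In the product of the two truncations, the mode \<open>(j, k)\<close> shifts the
    frequency by \<open>(real j - real k) * w\<close>. Only the diagonal \<open>j = k\<close> has a
    nonzero mean, and only if \<open>l = 0\<close>.\<close>
  have partial: "has_mean (\<lambda>t. (p 1 N t * p (- 1) N t) * (iexp (l * t) * G t))
      (if l = 0 then (\<Sum>j<N. (c j)\<^sup>2) * P else 0)" for N
  proof -
    have "has_mean (\<lambda>t. \<Sum>j<N. \<Sum>k<N. c j * (c k * (iexp ((l + (real j - real k) * w) * t) * G t)))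
        (\<Sum>j<N. \<Sum>k<N. if l = 0 \<and> j = k then c j * (c j * P) else 0)"
      by (intro has_mean_sum mode)
    also have "(\<lambda>t. \<Sum>j<N. \<Sum>k<N. c j * (c k * (iexp ((l + (real j - real k) * w) * t) * G t))) =
        (\<lambda>t. (p 1 N t * p (- 1) N t) * (iexp (l * t) * G t))"
    proof
      fix t
      have "iexp ((l + (real j - real k) * w) * t) =
          iexp (real j * (1 * w * t)) * iexp (real k * (- 1 * w * t)) * iexp (l * t)" for j k
        by (simp add: algebra_simps flip: exp_add)
      then show "(\<Sum>j<N. \<Sum>k<N. c j * (c k * (iexp ((l + (real j - real k) * w) * t) * G t))) =
          (p 1 N t * p (- 1) N t) * (iexp (l * t) * G t)"
        unfolding p_def sum_product unfolding sum_distrib_right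
        by (intro sum.cong refl) (simp only: mult_ac)
    qed
    also have "(\<Sum>j<N. \<Sum>k<N. if l = 0 \<and> j = k then c j * (c j * P) else 0) =
        (if l = 0 then (\<Sum>j<N. (c j)\<^sup>2) * P else 0)"
      by (auto simp: sum_distrib_left power2_eq_square mult_ac)
    finally show ?thesis .
  qed
  \<comment> \<open>Boundedness of the limit functions is what lets uniform convergence pass to
    products.\<close>
  have bdd_iexp: "bounded (range (\<lambda>t. exp (complex_of_real (x w / 2) * iexp (s * w * t))))" for s
  proof (rule boundedI)
    show "norm z \<le> exp \<bar>x w / 2\<bar>"
      if "z \<in> range (\<lambda>t. exp (complex_of_real (x w / 2) * iexp (s * w * t)))" for z
    proof -
      from that obtain t where "z = exp (complex_of_real (x w / 2) * iexp (s * w * t))"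
        by blast
      then have "norm z \<le> exp (norm (complex_of_real (x w / 2) * iexp (s * w * t)))"
        by (simp only: norm_exp)
      then show ?thesis
        by (simp add: norm_mult del: of_real_mult)
    qed
  qed
  have bdd_G: "bounded (range (\<lambda>t. iexp (l * t) * G t))"
  proof (rule boundedI)
    show "norm z \<le> (\<Prod>w\<in>F. exp \<bar>x w\<bar>)" if "z \<in> range (\<lambda>t. iexp (l * t) * G t)" for z
    proof -
      from that obtain t where z: "z = iexp (l * t) * G t"
        by blast
      have "x v * cos (v * t) \<le> \<bar>x v\<bar>" for v
        using mult_left_mono[OF abs_cos_le_one[of "v * t"], of "\<bar>x v\<bar>"]
        by (simp flip: abs_mult)
      then show ?thesis
        unfolding z G_def norm_mult prod_norm[symmetric] norm_exp_i_times
        by (auto intro!: prod_mono simp: norm_exp_eq_Re)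
    qed
  qed
  have ul_p: "uniform_limit UNIV (p s) (\<lambda>t. exp (complex_of_real (x w / 2) * iexp (s * w * t))) sequentially" for s
    using uniform_limit_exp_iexp[of "x w / 2" "s * w"] by (simp only: p_def [abs_def] c_def)
  have bdd_mult: "bounded (range (\<lambda>t. u t * v t))" if "bounded (range u)" "bounded (range v)"
    for u v :: "real \<Rightarrow> complex"
  proof -
    from that obtain B B' where "\<And>t. norm (u t) \<le> B" "\<And>t. norm (v t) \<le> B'"
      unfolding bounded_iff by blast
    then have "norm (u t * v t) \<le> B * B'" for t
      unfolding norm_mult by (meson mult_mono norm_ge_zero order_trans)
    then show ?thesis
      unfolding bounded_iff by blast
  qed
  have "uniform_limit UNIV (\<lambda>N t. (p 1 N t * p (- 1) N t) * (iexp (l * t) * G t))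
      (\<lambda>t. (exp (complex_of_real (x w / 2) * iexp (1 * w * t)) *
            exp (complex_of_real (x w / 2) * iexp (- 1 * w * t))) * (iexp (l * t) * G t)) sequentially"
    by (intro uniform_lim_mult ul_p bdd_iexp bdd_G bdd_mult uniform_limit_const)
  also have "(\<lambda>t. (exp (complex_of_real (x w / 2) * iexp (1 * w * t)) *
      exp (complex_of_real (x w / 2) * iexp (- 1 * w * t))) * (iexp (l * t) * G t)) =
      (\<lambda>t. iexp (l * t) * (\<Prod>w\<in>insert w F. exp (complex_of_real (x w * cos (w * t)))))"
  proof
    fix t
    show "(exp (complex_of_real (x w / 2) * iexp (1 * w * t)) *
      exp (complex_of_real (x w / 2) * iexp (- 1 * w * t))) * (iexp (l * t) * G t) =
      iexp (l * t) * (\<Prod>w\<in>insert w F. exp (complex_of_real (x w * cos (w * t))))"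
      using exp_cos_eq[of "x w" "w * t"] insert.hyps by (simp add: G_def)
  qed
  finally have ul: "uniform_limit UNIV (\<lambda>N t. (p 1 N t * p (- 1) N t) * (iexp (l * t) * G t))
      (\<lambda>t. iexp (l * t) * (\<Prod>w\<in>insert w F. exp (complex_of_real (x w * cos (w * t))))) sequentially" .
  have "(\<lambda>N. \<Sum>j<N. (c j)\<^sup>2) \<longlonglongrightarrow> bessel_J0 (\<i> * of_real (x w))"
    using sums_bessel_J0_imaginary[of "x w"] by (simp add: sums_def c_def)
  from tendsto_mult_right[OF this, of P]
  have lim: "(\<lambda>N. if l = 0 then (\<Sum>j<N. (c j)\<^sup>2) * P else 0) \<longlonglongrightarrow>
      (if l = 0 then \<Prod>w\<in>insert w F. bessel_J0 (\<i> * of_real (x w)) else 0)"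
    using insert.hyps by (simp add: P_def)
  show ?case
    by (rule has_mean_uniform_limit[OF ul _ always_eventually[OF allI[OF partial]] lim]) simp
qed

section \<open>Continuous functions are Riemann integrable\<close>

text \<open>Makes the test function of the main proof admissible in \<open>is_M_function\<close>. By
  uniform continuity, a mesh below \<open>d\<close> makes the error on each piece at most
  \<open>e'\<close> times its length.\<close>

lemma continuous_imp_locally_riemann_integrable:
  assumes "continuous_on UNIV \<Phi>"
  shows "locally_riemann_integrable \<Phi>"
  unfolding locally_riemann_integrable_def riemann_integrable_def
\<comment> \<open>The witness stays schematic here; the final \<open>show\<close> sets it to the
  gauge integral over \<open>{a..b}\<close>, which is independent of \<open>e\<close>.\<close>
proof (intro allI impI, rule exI, intro allI impI)
  fix a b e :: real assume "a \<le> b" "e > 0"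
  \<comment> \<open>The \<open>+ 1\<close> keeps the denominator positive even for
    \<open>a = b\<close>.\<close>
  define e' where "e' = e / (2 * (b - a + 1))"
  have "e' > 0"
    using \<open>a \<le> b\<close> \<open>e > 0\<close> by (simp add: e'_def)
  have e': "e' * (b - a) < e"
    using \<open>a \<le> b\<close> \<open>e > 0\<close> mult_strict_left_mono[of "b - a" "2 * (b - a + 1)" e]
    by (simp add: e'_def pos_divide_less_eq)
  have cont: "continuous_on {a..b} \<Phi>"
    using assms by (rule continuous_on_subset) simp
  then have "uniformly_continuous_on {a..b} \<Phi>"
    by (intro compact_uniformly_continuous) auto
  then obtain d where "d > 0" and d: "\<And>s t. s \<in> {a..b} \<Longrightarrow> t \<in> {a..b} \<Longrightarrow> dist t s < d \<Longrightarrow> dist (\<Phi> t) (\<Phi> s) < e'"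
    using \<open>e' > 0\<close> unfolding uniformly_continuous_on_def by meson
  have "norm ((\<Sum>(x, K)\<in>p. measure lborel K *\<^sub>R \<Phi> x) - integral {a..b} \<Phi>) < e"
    if p: "p tagged_division_of {a..b}" and fine: "\<forall>(x, K)\<in>p. diameter K < d" for p
  proof -
    have "(\<Sum>(x, K)\<in>p. measure lborel K *\<^sub>R \<Phi> x) - integral {a..b} \<Phi> =
        (\<Sum>(x, K)\<in>p. measure lborel K *\<^sub>R \<Phi> x - integral K \<Phi>)"
      using integral_combine_tagged_division_topdown[of \<Phi> a b p] p cont
      by (simp add: case_prod_unfold sum_subtractf integrable_continuous_interval)
    also have "norm \<dots> \<le> (\<Sum>(x, K)\<in>p. e' * measure lborel K)"
    proof (rule sum_norm_le, clarify)
      fix x K assume xK: "(x, K) \<in> p"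
      obtain u v where K: "K = {u..v}"
        using tagged_division_ofD(4)[OF p xK] by auto
      have "x \<in> K" and sub: "K \<subseteq> {a..b}"
        using tagged_division_ofD(2,3)[OF p xK] by auto
      then have "u \<le> v"
        by (simp add: K)
      have bound: "norm (\<Phi> x - \<Phi> t) \<le> e'" if "t \<in> K" for t
      proof -
        have "dist x t \<le> diameter K"
          using \<open>x \<in> K\<close> that by (intro diameter_bounded_bound) (auto simp: K)
        also have "\<dots> < d"
          using fine xK by auto
        finally have "dist (\<Phi> x) (\<Phi> t) < e'"
          using \<open>x \<in> K\<close> that sub by (intro d) (auto simp: dist_commute)
        then show ?thesis
          by (simp add: dist_norm)
      qed
      have contK: "continuous_on {u..v} \<Phi>"
        using cont sub by (auto intro: continuous_on_subset simp: K)
      have "measure lborel K *\<^sub>R \<Phi> x - integral K \<Phi> = integral {u..v} (\<lambda>t. \<Phi> x - \<Phi> t)"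
        using \<open>u \<le> v\<close> contK
        by (subst integral_diff) (auto simp: K integrable_continuous_interval)
      also have "norm \<dots> \<le> integral {u..v} (\<lambda>t. e')"
        using bound contK
        by (intro integral_norm_bound_integral integrable_continuous_interval continuous_intros)
           (auto simp: K)
      also have "\<dots> = e' * measure lborel K"
        using \<open>u \<le> v\<close> by (simp add: K)
      finally show "norm (measure lborel K *\<^sub>R \<Phi> x - integral K \<Phi>) \<le> e' * measure lborel K" .
    qed
    also have "\<dots> = e' * (b - a)"
      using additive_content_tagged_division[of p a b] p \<open>a \<le> b\<close>
      by (simp add: case_prod_unfold flip: sum_distrib_left)
    finally show ?thesis
      using e' by simp
  qed
  with \<open>d > 0\<close> show "\<exists>d>0. \<forall>p. p tagged_division_of {a..b} \<and> (\<forall>(x, K)\<in>p. diameter K < d) \<longrightarrow>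
      norm ((\<Sum>(x, K)\<in>p. measure lborel K *\<^sub>R \<Phi> x) - integral {a..b} \<Phi>) < e"
    by blast
qed

section \<open>The point mass at the origin\<close>

theorem theorem5p1:
  fixes \<Omega> :: "real set" and a :: "real \<Rightarrow> complex" and y :: real
    and \<mu> :: "real measure" and M :: "real \<Rightarrow> real"
  assumes "countable \<Omega>" and "0 \<notin> \<Omega>"
    and "infinite \<Omega> \<or> 5 \<le> card \<Omega>"
    and "\<And>\<omega>. \<omega> \<in> \<Omega> \<Longrightarrow> a \<omega> \<in> \<real> \<and> 0 < Re (a \<omega>)"
    and "(\<lambda>\<omega>. norm (a \<omega>)) summable_on \<Omega>"
    and "rat_independent \<Omega>"
    and "0 < y"
    and "infinitely_divisible \<mu>"
    and "\<And>t. char \<mu> t = exp (of_real (y * Re (g_Pi \<Omega> a t)))"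
    and "is_M_function (\<lambda>t. Re (f_Pi \<Omega> a t)) M"
  shows "unordered_prod_converges
             (\<lambda>\<omega>. bessel_J0 (\<i> * of_real (y * norm (a \<omega>)))) \<Omega> \<and>
         of_real (measure \<mu> {0}) =
           exp (- of_real y * f_Pi \<Omega> a 0) * M_transform M (- \<i> * of_real y) \<and>
         exp (- of_real y * f_Pi \<Omega> a 0) * M_transform M (- \<i> * of_real y) =
           exp (- of_real y * f_Pi \<Omega> a 0) *
           unordered_prod (\<lambda>\<omega>. bessel_J0 (\<i> * of_real (y * norm (a \<omega>)))) \<Omega>"
proof -
  define h where "h t = Re (f_Pi \<Omega> a t)" for t
  define S where "S = (\<Sum>\<^sub>\<infinity>\<omega>\<in>\<Omega>. norm (a \<omega>))"
  define E where "E t = exp (complex_of_real (y * h t))" for t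
  define m where "m = M_transform M (- \<i> * of_real y)"
  define b where "b \<omega> = bessel_J0 (\<i> * of_real (y * norm (a \<omega>)))" for \<omega>
  have a: "a \<omega> = of_real (norm (a \<omega>))" if "\<omega> \<in> \<Omega>" for \<omega>
    using assms(4)[OF that] by (auto elim!: Reals_cases)
  have norm_term: "norm (a \<omega> * exp (- \<i> * of_real t * of_real \<omega>)) = norm (a \<omega>)" for \<omega> t
    by (simp add: norm_mult)
  have "uniform_limit UNIV (\<lambda>F t. \<Sum>\<omega>\<in>F. a \<omega> * exp (- \<i> * of_real t * of_real \<omega>)) (f_Pi \<Omega> a)
      (finite_subsets_at_top \<Omega>)"
    unfolding f_Pi_def
    by (rule Weierstrass_m_test_general[where M = "\<lambda>\<omega>. norm (a \<omega>)"]) (use norm_term assms(5) in auto)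
  then have "uniform_limit UNIV (\<lambda>F t. Re (\<Sum>\<omega>\<in>F. a \<omega> * exp (- \<i> * of_real t * of_real \<omega>))) h
      (finite_subsets_at_top \<Omega>)"
    unfolding h_def by (rule bounded_linear.uniform_limit[OF bounded_linear_Re])
  also have "?this \<longleftrightarrow> uniform_limit UNIV (\<lambda>F t. \<Sum>\<omega>\<in>F. norm (a \<omega>) * cos (\<omega> * t)) h
      (finite_subsets_at_top \<Omega>)"
  proof (intro uniform_limit_cong eventually_finite_subsets_at_top_weakI ballI refl)
    fix F t assume "F \<subseteq> \<Omega>"
    have "Re (a \<omega> * exp (- \<i> * of_real t * of_real \<omega>)) = norm (a \<omega>) * cos (\<omega> * t)" if "\<omega> \<in> F" for \<omega>
    proof -
      have "a \<omega> = of_real (norm (a \<omega>))"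
        using a \<open>F \<subseteq> \<Omega>\<close> that by auto
      moreover have "Re (of_real r * exp (- \<i> * of_real t * of_real \<omega>)) = r * cos (\<omega> * t)" for r
        by (simp add: Re_exp mult.commute)
      ultimately show ?thesis
        by metis
    qed
    then show "Re (\<Sum>\<omega>\<in>F. a \<omega> * exp (- \<i> * of_real t * of_real \<omega>)) = (\<Sum>\<omega>\<in>F. norm (a \<omega>) * cos (\<omega> * t))"
      by simp
  qed
  finally have ul_h: "uniform_limit UNIV (\<lambda>F t. \<Sum>\<omega>\<in>F. norm (a \<omega>) * cos (\<omega> * t)) h
      (finite_subsets_at_top \<Omega>)" .
  have cont_h: "continuous_on UNIV h"
    by (rule uniform_limit_theorem[OF _ ul_h])
       (auto intro!: continuous_intros always_eventually)
  have bound_F: "\<bar>\<Sum>\<omega>\<in>F. norm (a \<omega>) * cos (\<omega> * t)\<bar> \<le> S" if "finite F" "F \<subseteq> \<Omega>" for F t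
  proof -
    have "\<bar>\<Sum>\<omega>\<in>F. norm (a \<omega>) * cos (\<omega> * t)\<bar> \<le> (\<Sum>\<omega>\<in>F. norm (a \<omega>))"
      using mult_left_mono[OF abs_cos_le_one norm_ge_zero]
      by (intro order_trans[OF sum_abs] sum_mono) (auto simp: abs_mult)
    also have "\<dots> \<le> S"
      unfolding S_def using that assms(5) by (intro finite_sum_le_infsum) auto
    finally show ?thesis .
  qed
  \<comment> \<open>The exponential is not uniformly continuous on the whole line, but all partial
    sums stay in the compact interval \<open>{-S..S}\<close>.\<close>
  have ul_E: "uniform_limit UNIV
      (\<lambda>F t. exp (complex_of_real (y * (\<Sum>\<omega>\<in>F. norm (a \<omega>) * cos (\<omega> * t))))) E
      (finite_subsets_at_top \<Omega>)"
    unfolding E_def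
  proof (rule uniform_limit_compose_uniformly_continuous_on[OF ul_h])
    show "uniformly_continuous_on {-S..S} (\<lambda>u. exp (complex_of_real (y * u)))"
      by (intro compact_uniformly_continuous continuous_intros) auto
    show "\<forall>\<^sub>F F in finite_subsets_at_top \<Omega>.
        \<forall>t\<in>UNIV. (\<Sum>\<omega>\<in>F. norm (a \<omega>) * cos (\<omega> * t)) \<in> {-S..S}"
    proof (intro eventually_finite_subsets_at_top_weakI ballI)
      fix F t assume "finite F" "F \<subseteq> \<Omega>"
      from bound_F[OF this, of t] show "(\<Sum>\<omega>\<in>F. norm (a \<omega>) * cos (\<omega> * t)) \<in> {-S..S}"
        unfolding atLeastAtMost_iff abs_le_iff by (intro conjI) linarith+
    qed
  qed auto
  have mean_E: "has_mean E m"
  proof -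
    \<comment> \<open>This is \<open>exp (y * u)\<close>, left in the form of the kernel of
      \<open>M_transform\<close> at \<open>- \<i> * of_real y\<close>, so that the limit supplied by
      \<open>is_M_function\<close> is literally \<open>m\<close>.\<close>
    let ?\<Phi> = "\<lambda>u. exp (\<i> * (- \<i> * of_real y) * complex_of_real u)"
    have E: "E = (\<lambda>t. ?\<Phi> (h t))"
      by (simp add: E_def fun_eq_iff)
    have cont_\<Phi>: "continuous_on UNIV ?\<Phi>"
      by (intro continuous_intros)
    have cont_E: "continuous_on UNIV E"
      unfolding E by (intro continuous_intros cont_h)
    have "locally_riemann_integrable ?\<Phi> \<and> (\<forall>T>0. (\<lambda>t. ?\<Phi> (h t)) integrable_on {0..T})"
      using continuous_imp_locally_riemann_integrable[OF cont_\<Phi>] integrable_continuous_UNIV[OF cont_E]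
      unfolding E by blast
    then have "((\<lambda>T. (1 / T) *\<^sub>R integral {0..T} (\<lambda>t. ?\<Phi> (h t))) \<longlongrightarrow> m) at_top"
      using assms(10) unfolding is_M_function_def m_def M_transform_def h_def by blast
    with cont_E show ?thesis
      unfolding E has_mean_def by blast
  qed
  have indep: "rat_real.independent \<Omega>"
    using assms(6) by (simp add: rat_independent_def)
  \<comment> \<open>The mean of the limit \<open>E\<close> is already known to be \<open>m\<close>,
    so the means over finite sets of frequencies must converge to it.\<close>
  have "((\<lambda>F. \<Prod>\<omega>\<in>F. b \<omega>) \<longlongrightarrow> m) (finite_subsets_at_top \<Omega>)"
  proof (rule tendsto_mean_uniform_limit[OF ul_E _ mean_E], rule eventually_finite_subsets_at_top_weakI)
    fix F assume F: "finite F" "F \<subseteq> \<Omega>"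
    \<comment> \<open>The case of trivial twist, \<open>l = 0\<close>.\<close>
    have "has_mean (\<lambda>t. \<Prod>\<omega>\<in>F. exp (complex_of_real (y * norm (a \<omega>) * cos (\<omega> * t)))) (\<Prod>\<omega>\<in>F. b \<omega>)"
      using has_mean_prod_exp_cos[of F 0 "\<lambda>\<omega>. y * norm (a \<omega>)"] F rat_real.independent_mono[OF indep]
      by (simp add: b_def)
    then show "has_mean (\<lambda>t. exp (complex_of_real (y * (\<Sum>\<omega>\<in>F. norm (a \<omega>) * cos (\<omega> * t))))) (\<Prod>\<omega>\<in>F. b \<omega>)"
      using F by (simp add: sum_distrib_left exp_sum mult.assoc)
  qed
  then have conv: "unordered_prod_converges b \<Omega>" and prod: "unordered_prod b \<Omega> = m"
    unfolding unordered_prod_converges_def unordered_prod_def by (auto intro!: tendsto_Lim)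
  have "f_Pi \<Omega> a 0 = (\<Sum>\<^sub>\<infinity>\<omega>\<in>\<Omega>. complex_of_real (norm (a \<omega>)))"
    unfolding f_Pi_def using a by (intro infsum_cong) simp
  also have "\<dots> = of_real S"
    unfolding S_def using assms(5)
    by (intro infsumI iffD2[OF has_sum_of_real_iff] has_sum_infsum)
  finally have f0: "f_Pi \<Omega> a 0 = of_real S" .
  \<comment> \<open>Since \<open>f_Pi \<Omega> a 0\<close> is the real number \<open>S\<close>, the
    exponent is \<open>y * (h t - S)\<close>, and the constant factor splits off.\<close>
  have "char \<mu> = (\<lambda>t. exp (- of_real y * f_Pi \<Omega> a 0) * E t)"
    by (simp add: fun_eq_iff assms(9) g_Pi_def E_def h_def f0 algebra_simps flip: exp_add)
  then have "has_mean (char \<mu>) (exp (- of_real y * f_Pi \<Omega> a 0) * m)"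
    by (simp only: has_mean_cmult[OF mean_E])
  moreover have "real_distribution \<mu>"
    using assms(8) by (simp add: infinitely_divisible_def)
  \<comment> \<open>The mean of \<open>char \<mu>\<close> has been computed in two ways, and means
    are unique.\<close>
  ultimately have "of_real (measure \<mu> {0}) = exp (- of_real y * f_Pi \<Omega> a 0) * m"
    using has_mean_unique real_distribution.has_mean_char by blast
  with conv prod show ?thesis
    unfolding b_def m_def by simp
qed

end
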